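(* Let $L=\sum_{i=1}^n a_i\partial_i$ with $a_1,\dots,a_n\in A$ be a derivation of $A$. Then the homogeneous equation $L\phi=0$ has at most $n-1$ functionally independent solutions; that is, every functionally independent subset of $\operatorname{Ker}L=\{\phi\in A: L\phi=0\}$ has at most $n-1$ elements.
   Context: $A$ is a field of characteristic $0$, and $K\cong\mathbb{Q}$ is its subfield generated by $1$. $A$ is generated as a field by a set $\{x_1,\dots,x_n\}$ of $n$ distinct elements, different from $0$ and $1$, which is functionally independent. A finite set $\{\phi_1,\dots,\phi_r\}\subset A$ is called functionally independent if no nonzero polynomial in $r$ variables with coefficients in $K$ vanishes at $(\phi_1,\dots,\phi_r)$ (functional independence in $A$ is the same as algebraic independence over $K$). $A$ is also assumed to carry a partial order $\le$ such that $\psi_1>\psi_2$ and $\varphi_1\ge\varphi_2$ imply $\psi_1+\varphi_1>\psi_2+\varphi_2$, and $\psi^2\ge 0$ for all $\psi\in A$. $\partial_1,\dots,\partial_n$ are the $K$-linear derivations $A\to A$ determined by $\partial_i x_j=\delta_{ij}$.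
   Formalization: The derivation L is assumed to be nonzero (not all a_i are 0); for L = 0 the kernel is all of A and contains the n functionally independent elements x_1,…,x_n, so the claim fails. *)

theory Defs
  imports Complex_Main "HOL-Library.Poly_Mapping"
begin

definition is_subfield :: "'a::field set \<Rightarrow> bool" where
  "is_subfield S \<longleftrightarrow> 0 \<in> S \<and> 1 \<in> S \<and>
     (\<forall>a\<in>S. \<forall>b\<in>S. a + b \<in> S \<and> a * b \<in> S) \<and> (\<forall>a\<in>S. - a \<in> S \<and> inverse a \<in> S)"

definition field_generated_by :: "'a::field set \<Rightarrow> 'a set" where
  "field_generated_by X = is_subfield hull X"

abbreviation prime_field :: "'a::field set" where
  "prime_field \<equiv> field_generated_by {1}"

lemma prime_field_eq_Rats: "(prime_field :: 'a::field_char_0 set) = \<rat>"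
proof -
  have "\<rat> \<subseteq> S" if S: "is_subfield S" for S :: "'a set"
  proof
    have nat: "of_nat n \<in> S" for n :: nat
      using S by (induction n) (auto simp: is_subfield_def)
    have int: "of_int z \<in> S" for z :: int
      using nat S by (cases z rule: int_cases2) (auto simp: is_subfield_def)
    fix q :: 'a assume "q \<in> \<rat>"
    then obtain a b where "q = of_int a / of_int b"
      by (elim Rats_cases')
    then show "q \<in> S"
      using int S by (simp add: is_subfield_def divide_inverse)
  qed
  moreover have "is_subfield (\<rat> :: 'a set)"
    by (simp add: is_subfield_def)
  ultimately show ?thesis
    unfolding field_generated_by_def by (intro hull_unique) auto
qed

text \<open>Polynomials in variables of type \<open>'v\<close> are finitely supported maps from monomials
  (finitely supported exponent functions) to coefficients.\<close>

definition mpoly_vars :: "(('v \<Rightarrow>\<^sub>0 nat) \<Rightarrow>\<^sub>0 'a::zero) \<Rightarrow> 'v set" where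
  "mpoly_vars p = (\<Union>m\<in>Poly_Mapping.keys p. Poly_Mapping.keys m)"

definition mpoly_eval :: "('v \<Rightarrow> 'a) \<Rightarrow> (('v \<Rightarrow>\<^sub>0 nat) \<Rightarrow>\<^sub>0 'a::comm_semiring_1) \<Rightarrow> 'a" where
  "mpoly_eval f p =
     (\<Sum>m\<in>Poly_Mapping.keys p.
        Poly_Mapping.lookup p m * (\<Prod>v\<in>Poly_Mapping.keys m. f v ^ Poly_Mapping.lookup m v))"

text \<open>For a finite set \<open>F = {\<phi>\<^sub>1, \<dots>, \<phi>\<^sub>r}\<close> of \<open>r\<close> elements, the \<open>r\<close> polynomial variables are
  labelled by the elements of \<open>F\<close> themselves, so that evaluating at \<open>(\<phi>\<^sub>1, \<dots>, \<phi>\<^sub>r)\<close> substitutes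
  for each variable its own label.\<close>

definition functionally_independent :: "'a::field set \<Rightarrow> bool" where
  "functionally_independent F \<longleftrightarrow> finite F \<and>
     (\<forall>p :: ('a \<Rightarrow>\<^sub>0 nat) \<Rightarrow>\<^sub>0 'a.
        p \<noteq> 0 \<and> mpoly_vars p \<subseteq> F \<and> (\<forall>m. Poly_Mapping.lookup p m \<in> prime_field)
        \<longrightarrow> mpoly_eval (\<lambda>v. v) p \<noteq> 0)"

definition linear_derivation :: "('a::field \<Rightarrow> 'a) \<Rightarrow> bool" where
  "linear_derivation D \<longleftrightarrow>
     (\<forall>a b. D (a + b) = D a + D b) \<and>
     (\<forall>c\<in>prime_field. \<forall>a. D (c * a) = c * D a) \<and>
     (\<forall>a b. D (a * b) = D a * b + a * D b)"

end

theory Submission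
  imports Defs "HOL-Computational_Algebra.Polynomial" "HOL-Library.FuncSet"
begin

text \<open>
  Choose \<open>y\<close> with \<open>L y \<noteq> 0\<close>, and let \<open>F\<close> be a functionally independent set in the kernel of \<open>L\<close>.
  The kernel is a field that contains \<open>F\<close>, and \<open>y\<close> is transcendental over it: applying \<open>L\<close> to a
  relation \<open>p(y) = 0\<close> with coefficients in the kernel gives \<open>p'(y) * L y = 0\<close>, a relation of smaller
  degree, and in characteristic 0 this descends to \<open>p = 0\<close> (\<open>transcendental_over_kernel\<close>). Hence
  \<open>F \<union> {y}\<close> is still independent (\<open>monomials_independent_insert\<close>) and has one element more than \<open>F\<close>.

  It remains to see that a field generated by \<open>n\<close> elements has no independent set \<open>G\<close> of \<open>r > n\<close>
  elements (\<open>card_monomials_independent_le\<close>), which follows by counting dimensions over the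
  rationals. Write the elements of \<open>G\<close> as fractions with a common denominator \<open>q\<close>, where \<open>q\<close> and the
  numerators are polynomials of degree at most \<open>D\<close> in each generator. The \<open>(M + 1)\<^sup>r\<close> monomials in \<open>G\<close>
  with exponents at most \<open>M\<close>, multiplied by \<open>q\<close> to the power \<open>M * r\<close>, lie in the space of polynomials
  of degree at most \<open>D * M * r\<close> in each generator, of dimension at most \<open>(D * M * r + 1)\<^sup>n\<close>. For large
  \<open>M\<close> they are therefore linearly dependent.

  Independence is handled throughout in the form \<open>monomials_independent\<close>: the monomials in \<open>F\<close> form a
  linearly independent family over the rationals.
\<close>

section \<open>Linear algebra over the rationals\<close>

text \<open>A field of characteristic 0 as a vector space over its prime field, with scalars of
  type \<open>rat\<close>.\<close>

interpretation ratvs: vector_space "\<lambda>(q::rat) (v::'a::field_char_0). of_rat q * v"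
  by unfold_locales (simp_all add: algebra_simps of_rat_add of_rat_mult)

text \<open>The statement is about families rather than sets: vectors with different indices may coincide,
  and such a repetition already counts as a linear relation.\<close>

lemma (in vector_space) family_dependent:
  assumes I: "finite I" and B: "finite B" and f: "\<And>i. i \<in> I \<Longrightarrow> f i \<in> span B"
    and less: "card B < card I"
  shows "\<exists>c. (\<exists>i\<in>I. c i \<noteq> 0) \<and> (\<Sum>i\<in>I. scale (c i) (f i)) = 0"
proof (cases "inj_on f I")
  case True
  have "dependent (f ` I)"
    using independent_span_bound[OF B, of "f ` I"] f less card_image[OF True] by force
  then obtain u v where uv: "v \<in> f ` I" "u v \<noteq> 0" "(\<Sum>v\<in>f ` I. scale (u v) v) = 0"
    using I by (auto simp: dependent_finite)
  then have "(\<Sum>i\<in>I. scale (u (f i)) (f i)) = 0"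
    by (simp add: sum.reindex[OF True])
  with uv show ?thesis
    by (intro exI[of _ "u \<circ> f"]) auto
next
  case False
  then obtain i j where ij: "i \<in> I" "j \<in> I" "i \<noteq> j" "f i = f j"
    by (auto simp: inj_on_def)
  define c where "c k = (if k = i then 1 else if k = j then - 1 else (0::'a))" for k
  have "(\<Sum>k\<in>I. scale (c k) (f k)) = (\<Sum>k\<in>{i, j}. scale (c k) (f k))"
    using ij I by (intro sum.mono_neutral_right) (auto simp: c_def)
  also have "\<dots> = 0"
    using ij by (simp add: c_def)
  finally show ?thesis
    using ij by (intro exI[of _ c]) (auto simp: c_def)
qed

lemma rat_span_mult:
  fixes a b :: "'a::field_char_0"
  assumes a: "a \<in> ratvs.span S" and b: "b \<in> ratvs.span T"
    and ST: "\<And>s t. s \<in> S \<Longrightarrow> t \<in> T \<Longrightarrow> s * t \<in> ratvs.span U"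
  shows "a * b \<in> ratvs.span U"
proof -
  have 1: "s * b \<in> ratvs.span U" if s: "s \<in> S" for s
    using b
  proof (induction rule: ratvs.span_induct_alt)
    case base
    show ?case by (simp add: ratvs.span_zero)
  next
    case (step c t y)
    have "s * (of_rat c * t + y) = of_rat c * (s * t) + s * y"
      by (simp add: algebra_simps)
    then show ?case
      using ST[OF s step(1)] step(2) by (metis ratvs.span_add ratvs.span_scale)
  qed
  show ?thesis
    using a
  proof (induction rule: ratvs.span_induct_alt)
    case base
    show ?case by (simp add: ratvs.span_zero)
  next
    case (step c s y)
    have "(of_rat c * s + y) * b = of_rat c * (s * b) + y * b"
      by (simp add: algebra_simps)
    then show ?case
      using 1[OF step(1)] step(2) by (metis ratvs.span_add ratvs.span_scale)
  qed
qed

section \<open>Monomials with bounded exponents\<close>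

text \<open>The variables of a monomial are labelled by the elements of \<open>F\<close>, and each is replaced by its
  own label, so a monomial here is its value in the field.\<close>

definition monomial :: "'a::comm_monoid_mult set \<Rightarrow> ('a \<Rightarrow> nat) \<Rightarrow> 'a" where
  "monomial F e = (\<Prod>v\<in>F. v ^ e v)"

text \<open>The degree in each variable is bounded, rather than the total degree. Exponent functions are
  \<open>undefined\<close> outside \<open>F\<close>, so that each monomial has exactly one of them.\<close>

definition exponents :: "'a set \<Rightarrow> nat \<Rightarrow> ('a \<Rightarrow> nat) set" where
  "exponents F M = F \<rightarrow>\<^sub>E {..M}"

lemma finite_exponents: "finite F \<Longrightarrow> finite (exponents F M)"
  by (simp add: exponents_def finite_PiE)

lemma card_exponents: "finite F \<Longrightarrow> card (exponents F M) = (M + 1) ^ card F"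
  by (simp add: exponents_def card_PiE)

text \<open>Algebraic independence over the rationals: the family of monomials in \<open>F\<close>, indexed by their
  exponents, is linearly independent. Every finite relation is covered by some bound \<open>M\<close>.\<close>

definition monomials_independent :: "'a::field_char_0 set \<Rightarrow> bool" where
  "monomials_independent F \<longleftrightarrow> finite F \<and>
     (\<forall>M. \<forall>c::('a \<Rightarrow> nat) \<Rightarrow> rat.
        (\<Sum>e\<in>exponents F M. of_rat (c e) * monomial F e) = 0 \<longrightarrow> (\<forall>e\<in>exponents F M. c e = 0))"

lemma functionally_independent_imp_monomials_independent:
  fixes F :: "'a::field_char_0 set"
  assumes "functionally_independent F"
  shows "monomials_independent F"
  unfolding monomials_independent_def
proof (intro conjI allI impI)
  show fin: "finite F"
    using assms by (simp add: functionally_independent_def)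
  fix M :: nat and c :: "('a \<Rightarrow> nat) \<Rightarrow> rat"
  let ?E = "exponents F M"
  assume sum0: "(\<Sum>e\<in>?E. of_rat (c e) * monomial F e) = 0"
  have finE: "finite ?E"
    using fin by (rule finite_exponents)
  \<comment> \<open>The exponent function \<open>e\<close> as a formal monomial, with the value outside \<open>F\<close> reset to 0.\<close>
  define h where "h e = Abs_poly_mapping (\<lambda>v. e v when v \<in> F)" for e :: "'a \<Rightarrow> nat"
  have lookup_h: "Poly_Mapping.lookup (h e) = (\<lambda>v. e v when v \<in> F)" for e
  proof -
    have "finite {v. (e v when v \<in> F) \<noteq> 0}"
      by (rule finite_subset[OF _ fin]) (auto simp: when_def)
    then show ?thesis
      unfolding h_def by simp
  qed
  have keys_h: "Poly_Mapping.keys (h e) \<subseteq> F" for e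
    by (auto simp: in_keys_iff lookup_h when_def split: if_splits)
  have inj_h: "inj_on h ?E"
  proof (rule inj_onI)
    fix d e assume de: "d \<in> ?E" "e \<in> ?E" "h d = h e"
    show "d = e"
    proof (rule PiE_ext)
      show "d \<in> F \<rightarrow>\<^sub>E {..M}" "e \<in> F \<rightarrow>\<^sub>E {..M}"
        using de by (simp_all add: exponents_def)
      show "d v = e v" if "v \<in> F" for v
        using arg_cong[OF de(3), of "\<lambda>m. Poly_Mapping.lookup m v"] that by (simp add: lookup_h)
    qed
  qed
  define p :: "('a \<Rightarrow>\<^sub>0 nat) \<Rightarrow>\<^sub>0 'a" where
    "p = (\<Sum>e\<in>?E. Poly_Mapping.single (h e) (of_rat (c e)))"
  have lookup_p: "Poly_Mapping.lookup p m = (\<Sum>e\<in>?E. of_rat (c e) when h e = m)" for m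
    by (simp add: p_def lookup_sum lookup_single)
  have lookup_p_h: "Poly_Mapping.lookup p (h e) = of_rat (c e)" if "e \<in> ?E" for e
  proof -
    have "Poly_Mapping.lookup p (h e) = (\<Sum>d\<in>?E. if d = e then of_rat (c d) else 0)"
      unfolding lookup_p using inj_h that
      by (intro sum.cong) (auto simp: when_def inj_on_def)
    with that finE show ?thesis
      by simp
  qed
  have keys_p: "Poly_Mapping.keys p \<subseteq> h ` ?E"
  proof
    fix m assume "m \<in> Poly_Mapping.keys p"
    then have "(\<Sum>e\<in>?E. of_rat (c e) when h e = m) \<noteq> (0::'a)"
      by (simp add: in_keys_iff lookup_p)
    then obtain e where "e \<in> ?E" "(of_rat (c e) when h e = m) \<noteq> (0::'a)"
      by (rule sum.not_neutral_contains_not_neutral)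
    then show "m \<in> h ` ?E"
      by (auto simp: when_def split: if_splits)
  qed
  have monomial_h: "(\<Prod>v\<in>Poly_Mapping.keys (h e). v ^ Poly_Mapping.lookup (h e) v) = monomial F e" for e
  proof -
    have "(\<Prod>v\<in>Poly_Mapping.keys (h e). v ^ Poly_Mapping.lookup (h e) v)
        = (\<Prod>v\<in>F. v ^ Poly_Mapping.lookup (h e) v)"
      by (rule prod.mono_neutral_left[OF fin keys_h]) (auto simp: in_keys_iff)
    then show ?thesis
      by (simp add: monomial_def lookup_h)
  qed
  have "mpoly_eval (\<lambda>v. v) p =
      (\<Sum>m\<in>h ` ?E. Poly_Mapping.lookup p m *
        (\<Prod>v\<in>Poly_Mapping.keys m. v ^ Poly_Mapping.lookup m v))"
    unfolding mpoly_eval_def using finE keys_p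
    by (intro sum.mono_neutral_left) (auto simp: in_keys_iff)
  also have "\<dots> = (\<Sum>e\<in>?E. of_rat (c e) * monomial F e)"
    by (simp add: sum.reindex[OF inj_h] lookup_p_h monomial_h cong: sum.cong)
  finally have "mpoly_eval (\<lambda>v. v) p = 0"
    using sum0 by simp
  moreover have "mpoly_vars p \<subseteq> F"
    using keys_p keys_h by (auto simp: mpoly_vars_def)
  moreover have "Poly_Mapping.lookup p m \<in> prime_field" for m
  proof -
    have "Poly_Mapping.lookup p m = of_rat (\<Sum>e\<in>?E. c e when h e = m)"
      unfolding lookup_p of_rat_sum by (intro sum.cong) (auto simp: when_def)
    then show ?thesis
      by (simp add: prime_field_eq_Rats)
  qed
  ultimately have "p = 0"
    using assms unfolding functionally_independent_def by blast
  then show "\<forall>e\<in>?E. c e = 0"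
    using lookup_p_h by auto
qed

section \<open>Transcendence degree bounded by the number of generators\<close>

text \<open>The values of the rational polynomials in \<open>X\<close> of degree at most \<open>D\<close> in each variable.\<close>

definition monomial_span :: "'a::field_char_0 set \<Rightarrow> nat \<Rightarrow> 'a set" where
  "monomial_span X D = ratvs.span (monomial X ` exponents X D)"

lemma monomial_span_mult:
  assumes X: "finite X" and "a \<in> monomial_span X D" "b \<in> monomial_span X D'"
  shows "a * b \<in> monomial_span X (D + D')"
  using assms(2,3) unfolding monomial_span_def
proof (rule rat_span_mult)
  fix s t assume "s \<in> monomial X ` exponents X D" "t \<in> monomial X ` exponents X D'"
  then obtain d e where s: "s = monomial X d" "d \<in> exponents X D"
    and t: "t = monomial X e" "e \<in> exponents X D'"
    by blast
  have "s * t = monomial X (restrict (\<lambda>v. d v + e v) X)"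
    by (simp add: s t monomial_def power_add prod.distrib cong: prod.cong)
  moreover have "restrict (\<lambda>v. d v + e v) X \<in> exponents X (D + D')"
    using s t by (auto simp: exponents_def PiE_iff intro: add_mono)
  ultimately show "s * t \<in> ratvs.span (monomial X ` exponents X (D + D'))"
    by (metis ratvs.span_base imageI)
qed

lemma one_in_monomial_span: "1 \<in> monomial_span X D"
proof -
  have "monomial X (restrict (\<lambda>_. 0) X) = 1"
    by (simp add: monomial_def)
  moreover have "restrict (\<lambda>_. 0) X \<in> exponents X D"
    by (auto simp: exponents_def)
  ultimately show ?thesis
    unfolding monomial_span_def by (metis ratvs.span_base imageI)
qed

lemma generator_in_monomial_span:
  assumes "finite X" "v \<in> X"
  shows "v \<in> monomial_span X 1"
proof -
  let ?e = "restrict (\<lambda>u. if u = v then 1 else 0) X"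
  have "monomial X ?e = (\<Prod>u\<in>X. if u = v then u else 1)"
    unfolding monomial_def by (intro prod.cong) auto
  also have "\<dots> = v"
    using assms by simp
  finally have "monomial X ?e = v" .
  moreover have "?e \<in> exponents X 1"
    by (auto simp: exponents_def)
  ultimately show ?thesis
    unfolding monomial_span_def by (metis ratvs.span_base imageI)
qed

lemma monomial_span_power:
  assumes "finite X" "a \<in> monomial_span X D"
  shows "a ^ k \<in> monomial_span X (D * k)"
proof (induction k)
  case (Suc k)
  then show ?case
    using monomial_span_mult[OF assms(1,2) Suc] by simp
qed (simp add: one_in_monomial_span)

lemma monomial_span_prod:
  assumes "finite X" "finite I" "\<And>i. i \<in> I \<Longrightarrow> f i \<in> monomial_span X D"
  shows "prod f I \<in> monomial_span X (D * card I)"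
  using assms(2,3)
proof (induction I rule: finite_induct)
  case (insert i I)
  then have "f i * prod f I \<in> monomial_span X (D + D * card I)"
    by (intro monomial_span_mult[OF assms(1)]) auto
  with insert show ?case
    by simp
qed (simp add: one_in_monomial_span)

lemma generated_field_fractions:
  fixes X :: "'a::field_char_0 set"
  assumes X: "finite X" and y: "y \<in> field_generated_by X"
  shows "\<exists>D q. q \<noteq> 0 \<and> q \<in> monomial_span X D \<and> q * y \<in> monomial_span X D"
proof -
  define S where "S = {y. \<exists>D q. q \<noteq> 0 \<and> q \<in> monomial_span X D \<and> q * y \<in> monomial_span X D}"
  note mult = monomial_span_mult[OF X]
  have "is_subfield S"
    unfolding is_subfield_def
  proof (intro conjI ballI)
    have "(1::'a) \<noteq> 0 \<and> 1 \<in> monomial_span X 0 \<and> 1 * z \<in> monomial_span X 0"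
      if "z = 0 \<or> z = 1" for z
      using that one_in_monomial_span[of X 0] by (auto simp: monomial_span_def ratvs.span_zero)
    from this[of 0] this[of 1] show "0 \<in> S" "1 \<in> S"
      unfolding S_def by (metis (mono_tags, lifting) mem_Collect_eq)+
  next
    fix a b assume "a \<in> S" "b \<in> S"
    then obtain D q D' q' where q: "q \<noteq> 0" "q \<in> monomial_span X D" "q * a \<in> monomial_span X D"
      and q': "q' \<noteq> 0" "q' \<in> monomial_span X D'" "q' * b \<in> monomial_span X D'"
      unfolding S_def by blast
    have qq': "q * q' \<noteq> 0" "q * q' \<in> monomial_span X (D + D')"
      using q q' mult by auto
    have "q * q' * (a + b) = (q * a) * q' + q * (q' * b)"
      by (simp add: algebra_simps)
    also have "\<dots> \<in> monomial_span X (D + D')"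
      using mult[OF q(3) q'(2)] mult[OF q(2) q'(3)]
      unfolding monomial_span_def by (rule ratvs.span_add)
    finally show "a + b \<in> S"
      using qq' unfolding S_def by blast
    have "q * q' * (a * b) = (q * a) * (q' * b)"
      by (simp add: algebra_simps)
    also have "\<dots> \<in> monomial_span X (D + D')"
      using mult[OF q(3) q'(3)] .
    finally show "a * b \<in> S"
      using qq' unfolding S_def by blast
  next
    fix a assume "a \<in> S"
    then obtain D q where q: "q \<noteq> 0" "q \<in> monomial_span X D" "q * a \<in> monomial_span X D"
      unfolding S_def by blast
    have "q * (- a) \<in> monomial_span X D"
      using q(3) unfolding monomial_span_def by (simp add: ratvs.span_neg)
    with q show "- a \<in> S"
      unfolding S_def by blast
    show "inverse a \<in> S"
    proof (cases "a = 0")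
      case True
      with \<open>a \<in> S\<close> show ?thesis by simp
    next
      case False
      then have "q * a \<noteq> 0" "q * a * inverse a = q"
        using q by auto
      with q show ?thesis
        unfolding S_def by (metis (mono_tags, lifting) mem_Collect_eq)
    qed
  qed
  moreover have "X \<subseteq> S"
  proof
    fix v assume "v \<in> X"
    then have "1 \<noteq> (0::'a)" "1 \<in> monomial_span X 1" "1 * v \<in> monomial_span X 1"
      using generator_in_monomial_span[OF X] one_in_monomial_span by auto
    then show "v \<in> S"
      unfolding S_def by blast
  qed
  ultimately have "field_generated_by X \<subseteq> S"
    unfolding field_generated_by_def by (rule hull_minimal[rotated])
  with y show ?thesis
    unfolding S_def by blast
qed

lemma common_denominator:
  fixes X :: "'a::field_char_0 set"
  assumes X: "finite X" and "finite G" "G \<subseteq> field_generated_by X"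
  shows "\<exists>D q. q \<noteq> 0 \<and> q \<in> monomial_span X D \<and> (\<forall>g\<in>G. q * g \<in> monomial_span X D)"
  using assms(2,3)
proof (induction G rule: finite_induct)
  case empty
  show ?case
    using one_in_monomial_span by (intro exI[of _ 0] exI[of _ 1]) auto
next
  case (insert y G)
  then obtain D q where q: "q \<noteq> 0" "q \<in> monomial_span X D" "\<forall>g\<in>G. q * g \<in> monomial_span X D"
    by auto
  obtain D' q' where q': "q' \<noteq> 0" "q' \<in> monomial_span X D'" "q' * y \<in> monomial_span X D'"
    using generated_field_fractions[OF X, of y] insert.prems by auto
  note mult = monomial_span_mult[OF X]
  have "q * q' * g \<in> monomial_span X (D + D')" if g: "g \<in> insert y G" for g
  proof (cases "g = y")
    case True
    with mult[OF q(2) q'(3)] show ?thesis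
      by (simp add: mult.assoc)
  next
    case False
    with g q have "q * g * q' \<in> monomial_span X (D + D')"
      using mult[OF _ q'(2), of "q * g" D] by auto
    then show ?thesis
      by (simp add: mult_ac)
  qed
  with q q' mult show ?case
    by (intro exI[of _ "D + D'"] exI[of _ "q * q'"]) auto
qed

text \<open>The transcendence degree is at most the number of generators. No exchange argument is needed,
  and \<open>X\<close> itself need not be independent.\<close>

lemma card_monomials_independent_le:
  fixes X G :: "'a::field_char_0 set"
  assumes X: "finite X" and G: "monomials_independent G" "G \<subseteq> field_generated_by X"
  shows "card G \<le> card X"
proof (rule ccontr)
  assume "\<not> card G \<le> card X"
  define r where "r = card G"
  define n where "n = card X"
  have rn: "Suc n \<le> r"
    using \<open>\<not> card G \<le> card X\<close> by (simp add: r_def n_def)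
  have finG: "finite G"
    using G by (simp add: monomials_independent_def)
  obtain D q where q: "q \<noteq> 0" "q \<in> monomial_span X D" "\<And>g. g \<in> G \<Longrightarrow> q * g \<in> monomial_span X D"
    using common_denominator[OF X finG G(2)] by blast
  have bound: "(M + 1) ^ r \<le> (D * M * r + 1) ^ n" for M
  proof (rule ccontr)
    assume gt: "\<not> (M + 1) ^ r \<le> (D * M * r + 1) ^ n"
    let ?B = "monomial X ` exponents X (D * M * r)"
    let ?f = "\<lambda>e. q ^ (M * r) * monomial G e"
    have "card ?B \<le> (D * M * r + 1) ^ n"
      using card_image_le[OF finite_exponents[OF X], of "monomial X" "D * M * r"]
      by (simp add: card_exponents[OF X] n_def)
    also have "\<dots> < card (exponents G M)"
      using gt by (simp add: card_exponents[OF finG] r_def)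
    finally have less: "card ?B < card (exponents G M)" .
    have "?f e \<in> ratvs.span ?B" if e: "e \<in> exponents G M" for e
    proof -
      have le: "e g \<le> M" if "g \<in> G" for g
        using e that by (auto simp: exponents_def)
      \<comment> \<open>The factor \<open>q ^ M\<close> available for each \<open>g\<close> clears the denominator of \<open>g ^ e g\<close>.\<close>
      have "?f e = (\<Prod>g\<in>G. q ^ M * g ^ e g)"
        by (simp add: monomial_def prod.distrib power_mult r_def)
      also have "\<dots> = (\<Prod>g\<in>G. (q * g) ^ e g * q ^ (M - e g))"
      proof (rule prod.cong[OF refl])
        fix g assume "g \<in> G"
        have "q ^ M = q ^ e g * q ^ (M - e g)"
          using le[OF \<open>g \<in> G\<close>] by (simp flip: power_add)
        then show "q ^ M * g ^ e g = (q * g) ^ e g * q ^ (M - e g)"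
          by (simp add: power_mult_distrib mult_ac)
      qed
      also have "\<dots> \<in> monomial_span X (D * M * card G)"
      proof (rule monomial_span_prod[OF X finG])
        fix g assume g: "g \<in> G"
        have "(q * g) ^ e g * q ^ (M - e g) \<in> monomial_span X (D * e g + D * (M - e g))"
          by (intro monomial_span_mult monomial_span_power X q g)
        also have "D * e g + D * (M - e g) = D * M"
          using le[OF g] by (simp flip: add_mult_distrib2)
        finally show "(q * g) ^ e g * q ^ (M - e g) \<in> monomial_span X (D * M)" .
      qed
      finally show ?thesis
        by (simp add: monomial_span_def r_def)
    qed
    then have "\<exists>c. (\<exists>e\<in>exponents G M. c e \<noteq> 0) \<and> (\<Sum>e\<in>exponents G M. of_rat (c e) * ?f e) = 0"
      by (intro ratvs.family_dependent[OF _ _ _ less] finite_imageI finite_exponents finG X)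
    then obtain c where c: "\<exists>e\<in>exponents G M. c e \<noteq> 0"
      and "(\<Sum>e\<in>exponents G M. of_rat (c e) * ?f e) = 0"
      by blast
    moreover have "(\<Sum>e\<in>exponents G M. of_rat (c e) * ?f e) =
        q ^ (M * r) * (\<Sum>e\<in>exponents G M. of_rat (c e) * monomial G e)"
      by (simp add: sum_distrib_left mult_ac)
    ultimately have "(\<Sum>e\<in>exponents G M. of_rat (c e) * monomial G e) = 0"
      using q by simp
    with G c show False
      unfolding monomials_independent_def by blast
  qed
  \<comment> \<open>Since \<open>D * M * r + 1 \<le> (D * r + 1) * (M + 1)\<close>, the bound with \<open>r \<ge> n + 1\<close> forces
    \<open>M + 1 \<le> (D * r + 1) ^ n\<close>; this \<open>M\<close> is the least that violates it.\<close>
  define M where "M = (D * r + 1) ^ n"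
  have "(M + 1) * (M + 1) ^ n \<le> (M + 1) ^ r"
    using power_increasing[OF rn, of "M + 1"] by simp
  also have "\<dots> \<le> (D * M * r + 1) ^ n"
    by (rule bound)
  also have "\<dots> \<le> ((D * r + 1) * (M + 1)) ^ n"
    by (intro power_mono) (auto simp: algebra_simps)
  also have "\<dots> = M * (M + 1) ^ n"
    by (simp only: M_def power_mult_distrib)
  finally show False
    by simp
qed

section \<open>Derivations and transcendence\<close>

lemma derivation_poly:
  fixes L :: "'a::field_char_0 \<Rightarrow> 'a"
  assumes add: "\<And>a b. L (a + b) = L a + L b" and mult: "\<And>a b. L (a * b) = L a * b + a * L b"
    and "\<And>i. L (coeff p i) = 0"
  shows "L (poly p y) = poly (pderiv p) y * L y"
  using assms(3)
proof (induction p)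
  case 0
  then show ?case
    using add[of 0 0] by simp
next
  case (pCons a p)
  have "L a = 0"
    using pCons.prems[of 0] by simp
  moreover have "L (poly p y) = poly (pderiv p) y * L y"
    using pCons.prems[of "Suc i" for i] by (intro pCons.IH) simp
  ultimately show ?case
    by (simp add: add mult pderiv_pCons algebra_simps)
qed

lemma transcendental_over_kernel:
  fixes L :: "'a::field_char_0 \<Rightarrow> 'a"
  assumes add: "\<And>a b. L (a + b) = L a + L b" and mult: "\<And>a b. L (a * b) = L a * b + a * L b"
    and y: "L y \<noteq> 0"
  assumes "\<And>i. L (coeff p i) = 0" "poly p y = 0"
  shows "p = 0"
  using assms(4,5)
proof (induction "degree p" arbitrary: p rule: less_induct)
  case less
  have L0: "L 0 = 0"
    using add[of 0 0] by simp
  have L1: "L 1 = 0"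
    using mult[of 1 1] by simp
  have Lnat: "L (of_nat k) = 0" for k
    by (induction k) (simp_all add: L0 L1 add)
  show ?case
  proof (cases "degree p = 0")
    case True
    with less.prems(2) show ?thesis
      by (auto elim: degree_eq_zeroE)
  next
    case False
    have "poly (pderiv p) y * L y = 0"
      using derivation_poly[of L p y, OF add mult less.prems(1)] less.prems(2) L0 by simp
    then have "pderiv p = 0"
      using y False Lnat less.prems(1)
      by (intro less.hyps) (auto simp: degree_pderiv coeff_pderiv mult simp del: of_nat_Suc)
    with False show ?thesis
      by (simp add: pderiv_eq_0_iff)
  qed
qed

lemma monomials_independent_insert:
  fixes L :: "'a::field_char_0 \<Rightarrow> 'a"
  assumes add: "\<And>a b. L (a + b) = L a + L b" and mult: "\<And>a b. L (a * b) = L a * b + a * L b"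
    and y: "L y \<noteq> 0" and F: "monomials_independent F" and ker: "\<And>v. v \<in> F \<Longrightarrow> L v = 0"
  shows "monomials_independent (insert y F)"
proof -
  have finF: "finite F"
    using F by (simp add: monomials_independent_def)
  have yF: "y \<notin> F"
    using y ker by auto
  have L0: "L 0 = 0"
    using add[of 0 0] by simp
  have L1: "L 1 = 0"
    using mult[of 1 1] by simp
  have Lsum: "L (sum f I) = 0" if "\<And>i. i \<in> I \<Longrightarrow> L (f i) = 0" for f :: "('a \<Rightarrow> nat) \<Rightarrow> 'a" and I
    using that by (induction I rule: infinite_finite_induct) (auto simp: L0 add)
  have Lprod: "L (prod f I) = 0" if "\<And>i. i \<in> I \<Longrightarrow> L (f i) = 0" for f :: "'a \<Rightarrow> 'a" and I
    using that by (induction I rule: infinite_finite_induct) (auto simp: L1 mult)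
  have Lpow: "L (v ^ k) = 0" if "L v = 0" for v k
    using that by (induction k) (auto simp: L1 mult)
  have Lnat: "L (of_nat k) = 0" for k
    by (induction k) (simp_all add: L0 L1 add)
  have Lint: "L (of_int k) = 0" for k
  proof (cases k rule: int_cases2)
    case (nonpos m)
    have "L (of_nat m + - of_nat m) = L (of_nat m) + L (- of_nat m)"
      by (rule add)
    with nonpos Lnat L0 show ?thesis by simp
  qed (simp add: Lnat)
  have Lrat: "L (of_rat c) = 0" for c
  proof -
    obtain a b where c: "c = of_int a / of_int b" and b: "b > 0"
      by (metis Fract_of_int_quotient Rat_cases)
    have "L (of_rat c * of_int b) = L (of_rat c) * of_int b + of_rat c * L (of_int b)"
      by (rule mult)
    with b show ?thesis
      by (simp add: c of_rat_divide Lint)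
  qed
  show ?thesis
    unfolding monomials_independent_def
  proof (intro conjI allI impI ballI)
    show "finite (insert y F)"
      using finF by simp
    fix M :: nat and c :: "('a \<Rightarrow> nat) \<Rightarrow> rat" and e
    assume sum0: "(\<Sum>e\<in>exponents (insert y F) M. of_rat (c e) * monomial (insert y F) e) = 0"
      and e: "e \<in> exponents (insert y F) M"
    \<comment> \<open>Collecting the powers of \<open>y\<close> turns the relation into a root \<open>y\<close> of a polynomial \<open>p\<close> whose
      coefficients \<open>b j\<close> are polynomials in \<open>F\<close>, hence lie in the kernel of \<open>L\<close>.\<close>
    let ?ins = "\<lambda>(j, d). d(y := j)"
    define b where "b j = (\<Sum>d\<in>exponents F M. of_rat (c (d(y := j))) * monomial F d)" for j :: nat
    define p where "p = (\<Sum>j\<le>M. monom (b j) j)"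
    have exps: "exponents (insert y F) M = ?ins ` ({..M} \<times> exponents F M)"
      unfolding exponents_def by (simp add: PiE_insert_eq)
    have inj: "inj_on ?ins ({..M} \<times> exponents F M)"
      unfolding exponents_def by (rule inj_combinator[OF yF])
    have mon: "monomial (insert y F) (d(y := j)) = y ^ j * monomial F d" for d j
    proof -
      have "(\<Prod>v\<in>F. v ^ (d(y := j)) v) = (\<Prod>v\<in>F. v ^ d v)"
        using yF by (intro prod.cong) auto
      then show ?thesis
        using finF yF by (simp add: monomial_def)
    qed
    have "(\<Sum>e\<in>exponents (insert y F) M. of_rat (c e) * monomial (insert y F) e) =
        (\<Sum>(j, d)\<in>{..M} \<times> exponents F M. of_rat (c (d(y := j))) * (y ^ j * monomial F d))"
      unfolding exps sum.reindex[OF inj] by (intro sum.cong) (auto simp: mon)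
    also have "\<dots> = (\<Sum>j\<le>M. b j * y ^ j)"
      by (simp add: sum.cartesian_product[symmetric] b_def sum_distrib_left sum_distrib_right mult_ac)
    also have "\<dots> = poly p y"
      by (simp add: p_def poly_sum poly_monom)
    finally have root: "poly p y = 0"
      using sum0 by simp
    have coeff_p: "coeff p j = (if j \<le> M then b j else 0)" for j
      by (simp add: p_def coeff_sum)
    have "L (b j) = 0" for j
      unfolding b_def monomial_def
      by (intro Lsum) (simp add: mult Lrat Lprod Lpow ker)
    then have "p = 0"
      by (intro transcendental_over_kernel[of L y p, OF add mult y _ root]) (simp add: coeff_p L0)
    obtain j d where jd: "j \<le> M" "d \<in> exponents F M" "e = d(y := j)"
      using e unfolding exps by auto
    with coeff_p[of j] \<open>p = 0\<close> have "b j = 0"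
      by simp
    with F have "\<forall>d\<in>exponents F M. c (d(y := j)) = 0"
      unfolding monomials_independent_def b_def by (elim conjE allE[of _ M] allE[of _ "\<lambda>d. c (d(y := j))"]) simp
    with jd show "c e = 0"
      by simp
  qed
qed

section \<open>Solutions of the homogeneous equation\<close>

theorem mainTheorem3:
  fixes x a :: "nat \<Rightarrow> 'a :: {field_char_0, order}"
    and n :: nat
    and pd :: "nat \<Rightarrow> 'a \<Rightarrow> 'a"
    and L :: "'a \<Rightarrow> 'a"
  assumes order_add:
      "\<And>\<psi>\<^sub>1 \<psi>\<^sub>2 \<phi>\<^sub>1 \<phi>\<^sub>2 :: 'a. \<psi>\<^sub>1 > \<psi>\<^sub>2 \<Longrightarrow> \<phi>\<^sub>1 \<ge> \<phi>\<^sub>2 \<Longrightarrow> \<psi>\<^sub>1 + \<phi>\<^sub>1 > \<psi>\<^sub>2 + \<phi>\<^sub>2"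
    and order_square: "\<And>\<psi> :: 'a. \<psi>\<^sup>2 \<ge> 0"
    and x_distinct: "inj_on x {1..n}"
    and x_not_0_1: "\<And>i. i \<in> {1..n} \<Longrightarrow> x i \<noteq> 0 \<and> x i \<noteq> 1"
    and x_generate: "field_generated_by (x ` {1..n}) = UNIV"
    and x_independent: "functionally_independent (x ` {1..n})"
    and partial_derivation: "\<And>i. i \<in> {1..n} \<Longrightarrow> linear_derivation (pd i)"
    and partial_x: "\<And>i j. i \<in> {1..n} \<Longrightarrow> j \<in> {1..n} \<Longrightarrow> pd i (x j) = (if i = j then 1 else 0)"
    and L_eq: "L = (\<lambda>\<phi>. \<Sum>i=1..n. a i * pd i \<phi>)"
    and L_nonzero: "L \<noteq> (\<lambda>\<phi>. 0)"
  shows "\<forall>F. F \<subseteq> {\<phi>. L \<phi> = 0} \<and> functionally_independent F \<longrightarrow> card F \<le> n - 1"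
proof (intro allI impI, elim conjE)
  fix F assume F: "F \<subseteq> {\<phi>. L \<phi> = 0}" "functionally_independent F"
  have add: "L (f + g) = L f + L g" for f g
    unfolding L_eq sum.distrib[symmetric] using partial_derivation
    by (intro sum.cong) (auto simp: linear_derivation_def algebra_simps)
  have mult: "L (f * g) = L f * g + f * L g" for f g
    unfolding L_eq sum_distrib_left sum_distrib_right sum.distrib[symmetric]
    using partial_derivation
    by (intro sum.cong) (auto simp: linear_derivation_def algebra_simps)
  obtain y where y: "L y \<noteq> 0"
    using L_nonzero by auto
  have "finite F" "y \<notin> F"
    using F y by (auto simp: functionally_independent_def)
  have "monomials_independent F"
    using F(2) by (rule functionally_independent_imp_monomials_independent)
  then have "monomials_independent (insert y F)"
    using F(1) by (intro monomials_independent_insert[of L, OF add mult y]) auto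
  then have "card (insert y F) \<le> card (x ` {1..n})"
    by (rule card_monomials_independent_le[rotated])
      (simp_all only: x_generate subset_UNIV finite_imageI finite_atLeastAtMost)
  also have "\<dots> \<le> n"
    using card_image_le[of "{1..n}" x] by simp
  finally show "card F \<le> n - 1"
    using \<open>finite F\<close> \<open>y \<notin> F\<close> by simp
qed

end
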